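(* Let $Y_1$ and $Y_2$ be subspaces of a space $X$, and let $Y_1'$ and $Y_2'$ be subspaces of a space $X'$. Let $\iota_j\colon Y_j\hookrightarrow X$ and $\iota_j'\colon Y_j'\hookrightarrow X'$ ($j=1,2$) be the inclusions. Suppose there are continuous maps $f\colon X\to X'$, $f'\colon X'\to X$, $\alpha_j\colon Y_j\to Y_j'$ and $\alpha_j'\colon Y_j'\to Y_j$ ($j=1,2$) such that for $j=1,2$ the map $f\circ\iota_j\circ\alpha_j'\colon Y_j'\to X'$ is homotopic to $\iota_j'$ and the map $f'\circ\iota_j'\circ\alpha_j\colon Y_j\to X$ is homotopic to $\iota_j$. Then $$\mathrm{TC}_{X'}(Y_1'\times Y_2')=\mathrm{TC}_X(Y_1\times Y_2).$$ In particular, this equality holds if there is a homotopy equivalence $f\colon X\to X'$ which restricts to homotopy equivalences $Y_j\to Y_j'$ for $j=1,2$.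
   Context: $I=[0,1]$. For a space $X$, $P(X)$ is the space of all continuous maps $\sigma\colon I\to X$ with the compact-open topology. For $A\subseteq X\times X$, $P_X(A)\subseteq P(X)$ is the subspace of paths $\sigma$ with $(\sigma(0),\sigma(1))\in A$, and $\mathrm{TC}_X(A)$ is the smallest integer $k$ such that $A$ has a cover by sets $U_1,\dots,U_k$ open in $A$ for which there are continuous maps $s_i\colon U_i\to P_X(A)$ with $s_i(x,y)(0)=x$ and $s_i(x,y)(1)=y$ for all $(x,y)\in U_i$; if no such $k$ exists, $\mathrm{TC}_X(A)=\infty$. *)

theory Defs
  imports "HOL-Analysis.Analysis" "HOL-Library.Extended_Nat"
begin

(* Continuous maps are represented by functions that are undefined off the carrier of X, so that
   points of the mapping space correspond one-to-one to continuous maps X \<rightarrow> Y. *)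
definition mapping_space :: "'a topology \<Rightarrow> 'b topology \<Rightarrow> ('a \<Rightarrow> 'b) set" where
  "mapping_space X Y = {f \<in> extensional (topspace X). continuous_map X Y f}"

definition compact_open_topology :: "'a topology \<Rightarrow> 'b topology \<Rightarrow> ('a \<Rightarrow> 'b) topology" where
  "compact_open_topology X Y =
     topology_generated_by {{f \<in> mapping_space X Y. f ` K \<subseteq> V} | K V. compactin X K \<and> openin Y V}"

lemma topspace_compact_open_topology [simp]:
  "topspace (compact_open_topology X Y) = mapping_space X Y"
proof -
  have "{f \<in> mapping_space X Y. f ` {} \<subseteq> {}}
          \<in> {{f \<in> mapping_space X Y. f ` K \<subseteq> V} | K V. compactin X K \<and> openin Y V}"
    using compactin_empty openin_empty by blast
  then show ?thesis
    unfolding compact_open_topology_def topology_generated_by_topspace by auto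
qed

definition path_space :: "'a topology \<Rightarrow> (real \<Rightarrow> 'a) topology" where
  "path_space X = compact_open_topology (top_of_set {0..1}) X"

definition path_space_on :: "'a topology \<Rightarrow> ('a \<times> 'a) set \<Rightarrow> (real \<Rightarrow> 'a) topology" where
  "path_space_on X A = subtopology (path_space X) {\<sigma>. (\<sigma> 0, \<sigma> 1) \<in> A}"

definition has_motion_planner :: "'a topology \<Rightarrow> ('a \<times> 'a) set \<Rightarrow> ('a \<times> 'a) set \<Rightarrow> bool" where
  "has_motion_planner X A U \<longleftrightarrow>
     (\<exists>s. continuous_map (subtopology (prod_topology X X) U) (path_space_on X A) s \<and>
          (\<forall>(x, y) \<in> U. s (x, y) 0 = x \<and> s (x, y) 1 = y))"

(* The infimum of the empty set is \<infinity>.  The value 0 occurs exactly for A = {} (empty cover). *)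
definition relative_TC :: "'a topology \<Rightarrow> ('a \<times> 'a) set \<Rightarrow> enat" where
  "relative_TC X A =
     Inf {enat k | k. \<exists>U :: nat \<Rightarrow> ('a \<times> 'a) set.
            (\<forall>i<k. openin (subtopology (prod_topology X X) A) (U i) \<and> has_motion_planner X A (U i)) \<and>
            (\<Union>i<k. U i) = A}"

(* The library only has homotopy_equivalent_space, which does not refer to a given map. *)
definition homotopy_equivalence_map :: "'a topology \<Rightarrow> 'b topology \<Rightarrow> ('a \<Rightarrow> 'b) \<Rightarrow> bool" where
  "homotopy_equivalence_map X Y f \<longleftrightarrow>
     continuous_map X Y f \<and>
     (\<exists>g. continuous_map Y X g \<and>
          homotopic_with (\<lambda>_. True) X X (g \<circ> f) id \<and>
          homotopic_with (\<lambda>_. True) Y Y (f \<circ> g) id)"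

end

theory Submission
  imports Defs
begin

text \<open>
  Since $[0,1]$ is compact Hausdorff, the exponential law identifies a motion planner over $U$ with
  a homotopy $\mathrm{fst} \simeq \mathrm{snd}$ of the two projections $U \to X$. Pulling such a
  homotopy back along $a = \alpha_1' \times \alpha_2'$ and composing with $f$ gives
  $\mathrm{fst} \simeq f \circ \alpha_1' \circ \mathrm{fst} \simeq f \circ \alpha_2' \circ
  \mathrm{snd} \simeq \mathrm{snd}$ over $a^{-1}(U)$, so a cover for $Y_1 \times Y_2$ yields one of
  the same size for $Y_1' \times Y_2'$. By symmetry the two invariants agree.
\<close>

section \<open>The exponential law for the compact-open topology\<close>

text \<open>Tube lemma: if the path at \<open>z\<close> sends the compact set \<open>K\<close> into
  \<open>V\<close>, then the open preimage of \<open>V\<close> under \<open>h\<close> contains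
  \<open>K \<times> {z}\<close>, hence some \<open>K \<times> N\<close> with \<open>N\<close> an
  open neighbourhood of \<open>z\<close>. So the preimage of each subbasic set is open.\<close>

lemma continuous_map_curry:
  assumes h: "continuous_map (prod_topology T Z) X h"
  shows "continuous_map Z (compact_open_topology T X) (\<lambda>z. \<lambda>t\<in>topspace T. h (t, z))"
proof -
  let ?s = "\<lambda>z. \<lambda>t\<in>topspace T. h (t, z)"
  have space: "?s z \<in> mapping_space T X" if "z \<in> topspace Z" for z
  proof -
    have "continuous_map T X (h \<circ> (\<lambda>t. (t, z)))"
      using that by (intro continuous_map_compose[OF _ h]) (simp add: continuous_map_pairwise o_def)
    then have "continuous_map T X (?s z)"
      by (rule continuous_map_eq) simp
    then show ?thesis
      by (simp add: mapping_space_def)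
  qed
  have openin: "openin Z (?s -` {f \<in> mapping_space T X. f ` K \<subseteq> V} \<inter> topspace Z)"
    if K: "compactin T K" and V: "openin X V" for K V
  proof (subst openin_subopen, intro ballI)
    fix z
    assume z: "z \<in> ?s -` {f \<in> mapping_space T X. f ` K \<subseteq> V} \<inter> topspace Z"
    have KT: "K \<subseteq> topspace T"
      using K by (rule compactin_subset_topspace)
    let ?W = "{w \<in> topspace (prod_topology T Z). h w \<in> V}"
    have "openin (prod_topology T Z) ?W"
      using h V by (rule openin_continuous_map_preimage)
    moreover have "K \<times> {z} \<subseteq> ?W"
      using z KT by fastforce
    ultimately obtain M N where "openin T M" and N: "openin Z N" "z \<in> N"
      and "K \<subseteq> M" "M \<times> N \<subseteq> ?W"
      using tube_lemma_left[of T Z ?W K z] K z by auto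
    then have "K \<times> N \<subseteq> ?W"
      by blast
    then have "N \<subseteq> ?s -` {f \<in> mapping_space T X. f ` K \<subseteq> V} \<inter> topspace Z"
      using KT openin_subset[OF N(1)] by (auto simp: space)
    with N show "\<exists>N. openin Z N \<and> z \<in> N \<and>
        N \<subseteq> ?s -` {f \<in> mapping_space T X. f ` K \<subseteq> V} \<inter> topspace Z"
      by blast
  qed
  show ?thesis
    unfolding compact_open_topology_def
  proof (rule continuous_on_generated_topo)
    fix B
    assume "B \<in> {{f \<in> mapping_space T X. f ` K \<subseteq> V} | K V. compactin T K \<and> openin X V}"
    then show "openin Z (?s -` B \<inter> topspace Z)"
      using openin by blast
  next
    \<comment> \<open>The union of the subbasis is the whole carrier
      \<open>mapping_space T X\<close>, so this is just \<open>space\<close>.\<close>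
    show "?s ` topspace Z \<subseteq> \<Union> {{f \<in> mapping_space T X. f ` K \<subseteq> V} | K V. compactin T K \<and> openin X V}"
      unfolding topology_generated_by_topspace[symmetric] compact_open_topology_def[symmetric]
      using space by auto
  qed
qed

lemma continuous_map_uncurry:
  assumes T: "neighbourhood_base_of (compactin T) T"
    and s: "continuous_map Z (compact_open_topology T X) s"
  shows "continuous_map (prod_topology T Z) X (\<lambda>(t, z). s z t)"
proof -
  have cont: "continuous_map T X (s z)" if "z \<in> topspace Z" for z
    using continuous_map_image_subset_topspace[OF s] that by (auto simp: mapping_space_def)
  show ?thesis
    unfolding continuous_map_eq_topcontinuous_at topcontinuous_at_def
  proof (intro ballI conjI allI impI)
    show "(\<lambda>(t, z). s z t) \<in> topspace (prod_topology T Z) \<rightarrow> topspace X"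
      using cont by (fastforce dest: continuous_map_image_subset_topspace)
  next
    fix w V
    assume w: "w \<in> topspace (prod_topology T Z)"
      and V: "openin X V \<and> (case w of (t, z) \<Rightarrow> s z t) \<in> V"
    obtain t z where w_eq: "w = (t, z)" and t: "t \<in> topspace T" and z: "z \<in> topspace Z"
      using w by auto
    have N: "openin T {t \<in> topspace T. s z t \<in> V}" "t \<in> {t \<in> topspace T. s z t \<in> V}"
      using openin_continuous_map_preimage[OF cont[OF z]] V t by (auto simp: w_eq)
    obtain M K where M: "openin T M" "t \<in> M" "M \<subseteq> K"
      and K: "compactin T K" "K \<subseteq> {t \<in> topspace T. s z t \<in> V}"
      using T[unfolded neighbourhood_base_of, rule_format, OF conjI[OF N]] by blast
    let ?B = "{f \<in> mapping_space T X. f ` K \<subseteq> V}"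
    have "openin (compact_open_topology T X) ?B"
      unfolding compact_open_topology_def
      using K(1) V by (intro topology_generated_by_Basis) blast
    then have "openin Z {z \<in> topspace Z. s z \<in> ?B}"
      by (rule openin_continuous_map_preimage[OF s])
    moreover have "s z \<in> ?B"
      using K(2) continuous_map_image_subset_topspace[OF s] z by auto
    ultimately show "\<exists>W. openin (prod_topology T Z) W \<and> w \<in> W \<and>
        (\<forall>y\<in>W. (case y of (t, z) \<Rightarrow> s z t) \<in> V)"
      \<comment> \<open>The first factor \<open>M\<close> keeps the time inside \<open>K\<close>,
        the second keeps the map in \<open>?B\<close>.\<close>
      using M z unfolding w_eq
      by (intro exI[of _ "M \<times> {z \<in> topspace Z. s z \<in> ?B}"])
        (auto simp: openin_prod_Times_iff)
  qed
qed

text \<open>Supplies the assumption on \<open>T\<close> in \<open>continuous_map_uncurry\<close> for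
  paths.\<close>

lemma neighbourhood_base_of_compactin_unit_interval:
  "neighbourhood_base_of (compactin (top_of_set {0..1::real})) (top_of_set {0..1})"
proof -
  have "compact_space (top_of_set {0..1::real})"
    by (simp add: compact_space_subtopology)
  moreover have "Hausdorff_space (top_of_set {0..1::real})"
    by (simp add: Hausdorff_space_subtopology)
  ultimately have "neighbourhood_base_of (\<lambda>C. compactin (top_of_set {0..1::real}) C \<and>
      closedin (top_of_set {0..1}) C) (top_of_set {0..1})"
    by (metis locally_compact_regular_space_neighbourhood_base
        compact_imp_locally_compact_space compact_Hausdorff_imp_regular_space)
  then show ?thesis
    by (rule neighbourhood_base_of_mono) simp
qed

section \<open>Motion planners as homotopies\<close>

text \<open>Both directions of the exponential law with \<open>T\<close> the unit interval. The
  inclusion of \<open>U\<close> in \<open>A\<close> ensures that the paths read off from a homotopy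
  have their endpoint pairs in \<open>A\<close>, as \<open>path_space_on\<close> demands.\<close>

lemma has_motion_planner_iff_homotopic:
  fixes X :: "'a topology"
  assumes "U \<subseteq> A"
  shows "has_motion_planner X A U \<longleftrightarrow>
    homotopic_with (\<lambda>_. True) (subtopology (prod_topology X X) U) X fst snd"
    (is "_ \<longleftrightarrow> homotopic_with _ ?Z X fst snd")
proof
  assume "has_motion_planner X A U"
  then obtain s where s: "continuous_map ?Z (path_space_on X A) s"
    and ends: "\<forall>(x, y) \<in> U. s (x, y) 0 = x \<and> s (x, y) 1 = y"
    unfolding has_motion_planner_def by blast
  have "continuous_map ?Z (compact_open_topology (top_of_set {0..1}) X) s"
    using s unfolding path_space_on_def path_space_def
    by (rule continuous_map_into_fulltopology)
  then have "continuous_map (prod_topology (top_of_set {0..1}) ?Z) X (\<lambda>(t, z). s z t)"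
    by (rule continuous_map_uncurry[OF neighbourhood_base_of_compactin_unit_interval])
  then show "homotopic_with (\<lambda>_. True) ?Z X fst snd"
    \<comment> \<open>The rule \<open>homotopic_with\<close> asks for the end conditions only on the
      carrier, whereas the definition asks for them at every argument; \<open>s\<close> controls
      them only on \<open>U\<close>.\<close>
    using ends by (subst homotopic_with) (auto intro!: exI[of _ "\<lambda>(t, z). s z t"])
next
  assume "homotopic_with (\<lambda>_. True) ?Z X fst snd"
  then obtain h :: "real \<times> 'a \<times> 'a \<Rightarrow> 'a"
    where h: "continuous_map (prod_topology (top_of_set {0..1}) ?Z) X h"
    and ends: "\<And>z. h (0, z) = fst z" "\<And>z. h (1, z) = snd z"
    unfolding homotopic_with_def by blast
  \<comment> \<open>Points of the path space are extensional, hence the restriction to the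
    interval.\<close>
  let ?s = "\<lambda>z. \<lambda>t\<in>{0..1}. h (t, z)"
  have "?s \<in> topspace ?Z \<rightarrow> {\<sigma>. (\<sigma> 0, \<sigma> 1) \<in> A}"
    using assms by (auto simp: ends)
  moreover have "continuous_map ?Z (compact_open_topology (top_of_set {0..1}) X) ?s"
    using continuous_map_curry[OF h] by simp
  ultimately have "continuous_map ?Z (path_space_on X A) ?s"
    unfolding path_space_on_def path_space_def by (simp add: continuous_map_in_subtopology)
  \<comment> \<open>\<open>ends\<close> holds at every \<open>z\<close>, so also at points of
    \<open>U\<close> outside the carrier, should there be any.\<close>
  moreover have "\<forall>(x, y) \<in> U. ?s (x, y) 0 = x \<and> ?s (x, y) 1 = y"
    by (simp add: ends)
  ultimately show "has_motion_planner X A U"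
    unfolding has_motion_planner_def by (intro exI[of _ ?s] conjI)
qed

section \<open>The inequality from one-sided homotopy data\<close>

text \<open>One half of the symmetric situation, to be applied twice with the two sides exchanged.
  The homotopies \<open>h1\<close> and \<open>h2\<close> may leave \<open>Y1'\<close> and
  \<open>Y2'\<close>: they become pieces of planner paths, which run through all of
  \<open>X'\<close>.\<close>

lemma relative_TC_dominated:
  fixes X :: "'a topology" and X' :: "'b topology"
  assumes f: "continuous_map X X' f"
    and a1: "continuous_map (subtopology X' Y1') (subtopology X Y1) a1"
    and a2: "continuous_map (subtopology X' Y2') (subtopology X Y2) a2"
    and h1: "homotopic_with (\<lambda>_. True) (subtopology X' Y1') X' (f \<circ> a1) id"
    and h2: "homotopic_with (\<lambda>_. True) (subtopology X' Y2') X' (f \<circ> a2) id"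
    and sub: "Y1' \<subseteq> topspace X'" "Y2' \<subseteq> topspace X'"
  shows "relative_TC X' (Y1' \<times> Y2') \<le> relative_TC X (Y1 \<times> Y2)"
proof -
  let ?A = "Y1 \<times> Y2" and ?A' = "Y1' \<times> Y2'"
  let ?T = "subtopology (prod_topology X X) ?A"
  let ?T' = "subtopology (prod_topology X' X') ?A'"
  define a where "a = (\<lambda>(x, y). (a1 x, a2 y))"
  define pull where "pull U = {z \<in> topspace ?T'. a z \<in> U}" for U
  have a: "continuous_map ?T' ?T a"
    unfolding a_def subtopology_Times using a1 a2 by (simp add: continuous_map_prod_top)
  have proj: "continuous_map ?T' (subtopology X' Y1') fst" "continuous_map ?T' (subtopology X' Y2') snd"
    unfolding subtopology_Times by (simp_all add: continuous_map_fst continuous_map_snd)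
  \<comment> \<open>By \<open>sub\<close> the carrier is all of \<open>?A'\<close>, so sets of the
    form \<open>pull U\<close> can cover it.\<close>
  have A': "?A' = topspace ?T'"
    using sub by auto
  have aA: "a ` ?A' \<subseteq> ?A"
    using continuous_map_image_subset_topspace[OF a] unfolding A'[symmetric] by simp
  have planner: "has_motion_planner X' ?A' (pull U)"
    if U: "openin ?T U" and mp: "has_motion_planner X ?A U" for U
  proof -
    have UA: "U \<subseteq> ?A"
      using openin_subset[OF U] by auto
    have pullA: "pull U \<subseteq> ?A'"
      unfolding pull_def by auto
    let ?P = "subtopology (prod_topology X' X') (pull U)"
    have P: "?P = subtopology ?T' (pull U)"
      using pullA by (simp add: subtopology_subtopology inf.absorb2)
    have "continuous_map ?P (prod_topology X X) a"
      unfolding P by (rule continuous_map_from_subtopology[OF continuous_map_into_fulltopology[OF a]])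
    then have aP: "continuous_map ?P (subtopology (prod_topology X X) U) a"
      by (rule continuous_map_into_subtopology) (auto simp: pull_def)
    have p1: "continuous_map ?P (subtopology X' Y1') fst" and p2: "continuous_map ?P (subtopology X' Y2') snd"
      unfolding P by (intro continuous_map_from_subtopology proj)+
    have "homotopic_with (\<lambda>_. True) (subtopology (prod_topology X X) U) X fst snd"
      using mp has_motion_planner_iff_homotopic[OF UA] by simp
    then have "homotopic_with (\<lambda>_. True) ?P X (fst \<circ> a) (snd \<circ> a)"
      by (rule homotopic_with_compose_continuous_map_right[OF _ aP]) simp
    then have "homotopic_with (\<lambda>_. True) ?P X' (f \<circ> (fst \<circ> a)) (f \<circ> (snd \<circ> a))"
      by (rule homotopic_with_compose_continuous_map_left[OF _ f]) simp
    \<comment> \<open>Since \<open>a\<close> acts coordinatewise, the transported homotopy starts at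
      \<open>f \<circ> a1 \<circ> fst\<close> and ends at \<open>f \<circ> a2 \<circ> snd\<close>.
      The two homotopies below join these to \<open>fst\<close> and \<open>snd\<close>.\<close>
    moreover have "f \<circ> (fst \<circ> a) = f \<circ> a1 \<circ> fst" "f \<circ> (snd \<circ> a) = f \<circ> a2 \<circ> snd"
      by (auto simp: a_def)
    moreover have "homotopic_with (\<lambda>_. True) ?P X' (f \<circ> a1 \<circ> fst) (id \<circ> fst)"
      by (rule homotopic_with_compose_continuous_map_right[OF h1 p1]) simp
    moreover have "homotopic_with (\<lambda>_. True) ?P X' (f \<circ> a2 \<circ> snd) (id \<circ> snd)"
      by (rule homotopic_with_compose_continuous_map_right[OF h2 p2]) simp
    ultimately have "homotopic_with (\<lambda>_. True) ?P X' fst snd"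
      unfolding id_o by (metis homotopic_with_symD homotopic_with_trans)
    then show ?thesis
      using has_motion_planner_iff_homotopic[OF pullA] by simp
  qed
  have cover: "\<exists>V :: nat \<Rightarrow> ('b \<times> 'b) set.
      (\<forall>i<k. openin ?T' (V i) \<and> has_motion_planner X' ?A' (V i)) \<and> (\<Union>i<k. V i) = ?A'"
    if U: "\<forall>i<k. openin ?T (U i) \<and> has_motion_planner X ?A (U i)"
      and UA: "(\<Union>i<k. U i) = ?A" for k and U :: "nat \<Rightarrow> ('a \<times> 'a) set"
  proof (intro exI[of _ "\<lambda>i. pull (U i)"] conjI allI impI)
    fix i
    assume i: "i < k"
    show "openin ?T' (pull (U i))"
      unfolding pull_def using U i by (blast intro: openin_continuous_map_preimage[OF a])
    show "has_motion_planner X' ?A' (pull (U i))"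
      using U i by (blast intro: planner)
  next
    \<comment> \<open>Preimages commute with unions, and \<open>a\<close> maps \<open>?A'\<close>
      into \<open>?A\<close>, which the \<open>U i\<close> cover.\<close>
    have "(\<Union>i<k. pull (U i)) = {z \<in> ?A'. a z \<in> (\<Union>i<k. U i)}"
      unfolding pull_def A'[symmetric] by blast
    then show "(\<Union>i<k. pull (U i)) = ?A'"
      using aA unfolding UA by blast
  qed
  show ?thesis
    unfolding relative_TC_def
  \<comment> \<open>A larger set has a smaller infimum, so it suffices that each cover size
    available for \<open>X\<close> is available for \<open>X'\<close>. This includes the value
    \<infinity>, the infimum of the empty set.\<close>
  proof (intro Inf_superset_mono subsetI; elim CollectE exE conjE)
    fix n k and U :: "nat \<Rightarrow> ('a \<times> 'a) set"
    assume "n = enat k" and "\<forall>i<k. openin ?T (U i) \<and> has_motion_planner X ?A (U i)"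
      and "(\<Union>i<k. U i) = ?A"
    with cover[of k U] show "n \<in> {enat k | k. \<exists>V.
        (\<forall>i<k. openin ?T' (V i) \<and> has_motion_planner X' ?A' (V i)) \<and> (\<Union>i<k. V i) = ?A'}"
      by (intro CollectI exI[of _ k] conjI)
  qed
qed

theorem theorem2p6:
  fixes X :: "'a topology" and X' :: "'b topology"
    and Y1 Y2 :: "'a set" and Y1' Y2' :: "'b set"
  assumes "Y1 \<subseteq> topspace X" and "Y2 \<subseteq> topspace X"
    and "Y1' \<subseteq> topspace X'" and "Y2' \<subseteq> topspace X'"
  shows
    "(\<forall>f f' \<alpha>1 \<alpha>2 \<alpha>1' \<alpha>2'.
        continuous_map X X' f \<and> continuous_map X' X f' \<and>
        continuous_map (subtopology X Y1) (subtopology X' Y1') \<alpha>1 \<and>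
        continuous_map (subtopology X Y2) (subtopology X' Y2') \<alpha>2 \<and>
        continuous_map (subtopology X' Y1') (subtopology X Y1) \<alpha>1' \<and>
        continuous_map (subtopology X' Y2') (subtopology X Y2) \<alpha>2' \<and>
        homotopic_with (\<lambda>_. True) (subtopology X' Y1') X' (f \<circ> \<alpha>1') id \<and>
        homotopic_with (\<lambda>_. True) (subtopology X' Y2') X' (f \<circ> \<alpha>2') id \<and>
        homotopic_with (\<lambda>_. True) (subtopology X Y1) X (f' \<circ> \<alpha>1) id \<and>
        homotopic_with (\<lambda>_. True) (subtopology X Y2) X (f' \<circ> \<alpha>2) id
        \<longrightarrow> relative_TC X' (Y1' \<times> Y2') = relative_TC X (Y1 \<times> Y2)) \<and>
     (\<forall>f.
        homotopy_equivalence_map X X' f \<and>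
        homotopy_equivalence_map (subtopology X Y1) (subtopology X' Y1') f \<and>
        homotopy_equivalence_map (subtopology X Y2) (subtopology X' Y2') f
        \<longrightarrow> relative_TC X' (Y1' \<times> Y2') = relative_TC X (Y1 \<times> Y2))"
proof (intro conjI allI impI)
  fix f f' \<alpha>1 \<alpha>2 \<alpha>1' \<alpha>2'
  assume *: "continuous_map X X' f \<and> continuous_map X' X f' \<and>
        continuous_map (subtopology X Y1) (subtopology X' Y1') \<alpha>1 \<and>
        continuous_map (subtopology X Y2) (subtopology X' Y2') \<alpha>2 \<and>
        continuous_map (subtopology X' Y1') (subtopology X Y1) \<alpha>1' \<and>
        continuous_map (subtopology X' Y2') (subtopology X Y2) \<alpha>2' \<and>
        homotopic_with (\<lambda>_. True) (subtopology X' Y1') X' (f \<circ> \<alpha>1') id \<and>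
        homotopic_with (\<lambda>_. True) (subtopology X' Y2') X' (f \<circ> \<alpha>2') id \<and>
        homotopic_with (\<lambda>_. True) (subtopology X Y1) X (f' \<circ> \<alpha>1) id \<and>
        homotopic_with (\<lambda>_. True) (subtopology X Y2) X (f' \<circ> \<alpha>2) id"
  show "relative_TC X' (Y1' \<times> Y2') = relative_TC X (Y1 \<times> Y2)"
  proof (rule antisym)
    show "relative_TC X' (Y1' \<times> Y2') \<le> relative_TC X (Y1 \<times> Y2)"
      by (rule relative_TC_dominated[of X X' f Y1' Y1 \<alpha>1' Y2' Y2 \<alpha>2']) (use * assms in blast)+
    \<comment> \<open>The two spaces exchanged: \<open>f'\<close> replaces \<open>f\<close>, and
      \<open>\<alpha>1\<close>, \<open>\<alpha>2\<close> replace the maps going back.\<close>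
    show "relative_TC X (Y1 \<times> Y2) \<le> relative_TC X' (Y1' \<times> Y2')"
      by (rule relative_TC_dominated[of X' X f' Y1 Y1' \<alpha>1 Y2 Y2' \<alpha>2]) (use * assms in blast)+
  qed
next
  fix f
  assume *: "homotopy_equivalence_map X X' f \<and>
        homotopy_equivalence_map (subtopology X Y1) (subtopology X' Y1') f \<and>
        homotopy_equivalence_map (subtopology X Y2) (subtopology X' Y2') f"
  \<comment> \<open>The homotopy inverse of the restricted \<open>f\<close> serves as the map back
    to \<open>Y\<close>.\<close>
  have dominates: "\<exists>g. continuous_map (subtopology X' Y') (subtopology X Y) g \<and>
      homotopic_with (\<lambda>_. True) (subtopology X' Y') X' (f \<circ> g) id"
    if equiv: "homotopy_equivalence_map (subtopology X Y) (subtopology X' Y') f" for Y Y'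
  proof -
    obtain g where g: "continuous_map (subtopology X' Y') (subtopology X Y) g"
      and h: "homotopic_with (\<lambda>_. True) (subtopology X' Y') (subtopology X' Y') (f \<circ> g) id"
      using equiv unfolding homotopy_equivalence_map_def by blast
    \<comment> \<open>The outer \<open>id\<close> is the inclusion of \<open>Y'\<close> in
      \<open>X'\<close>, which turns a homotopy within \<open>Y'\<close> into one in
      \<open>X'\<close>.\<close>
    have "homotopic_with (\<lambda>_. True) (subtopology X' Y') X' (id \<circ> (f \<circ> g)) (id \<circ> id)"
      by (rule homotopic_with_compose_continuous_map_left[OF h]) simp_all
    with g show ?thesis
      unfolding id_o by blast
  qed
  obtain g1 where g1: "continuous_map (subtopology X' Y1') (subtopology X Y1) g1"
      "homotopic_with (\<lambda>_. True) (subtopology X' Y1') X' (f \<circ> g1) id"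
    using dominates[of Y1 Y1'] * by blast
  obtain g2 where g2: "continuous_map (subtopology X' Y2') (subtopology X Y2) g2"
      "homotopic_with (\<lambda>_. True) (subtopology X' Y2') X' (f \<circ> g2) id"
    using dominates[of Y2 Y2'] * by blast
  obtain f' where f': "continuous_map X' X f'" "homotopic_with (\<lambda>_. True) X X (f' \<circ> f) id"
    using * unfolding homotopy_equivalence_map_def by blast
  have f: "continuous_map X X' f" "continuous_map (subtopology X Y1) (subtopology X' Y1') f"
    "continuous_map (subtopology X Y2) (subtopology X' Y2') f"
    using * by (auto simp: homotopy_equivalence_map_def)
  show "relative_TC X' (Y1' \<times> Y2') = relative_TC X (Y1 \<times> Y2)"
  proof (rule antisym)
    show "relative_TC X' (Y1' \<times> Y2') \<le> relative_TC X (Y1 \<times> Y2)"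
      by (rule relative_TC_dominated[OF f(1) g1(1) g2(1) g1(2) g2(2) assms(3,4)])
    \<comment> \<open>Here \<open>f\<close> itself serves as both maps from \<open>Y1\<close> and
      \<open>Y2\<close>, and the homotopy from \<open>f' \<circ> f\<close> to \<open>id\<close> on
      \<open>X\<close> restricts to these subspaces.\<close>
    show "relative_TC X (Y1 \<times> Y2) \<le> relative_TC X' (Y1' \<times> Y2')"
      by (rule relative_TC_dominated[OF f'(1) f(2,3) _ _ assms(1,2)])
        (intro homotopic_from_subtopology f'(2))+
  qed
qed

end
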